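(* Let $\Gamma$, $V$, $T$, $\Upsilon$, $\Psi$, $q$, $e$ be as in the context, and let $\pi_1,\pi_2:U_q(\mathfrak{sl}_2)\to\mathrm{End}(V)$ be the representations given by the first and second module structures described in the context. Then $$\pi_2(k)=\pi_1(k),\qquad \pi_2(e)=-q^{-2e}\Upsilon^2\Psi^{-2}\pi_1(e),\qquad \pi_2(f)=-q^{2e}\Upsilon^{-2}\Psi^{2}\pi_1(f).$$
   Context: Let $b$ be a prime power, $D\ge3$, and $U$ a finite-dimensional $\mathbb{F}_b$-space with one of the nondegenerate forms: symplectic, $\dim U=2D$ ($e=1$); quadratic, $\dim U=2D+1$ ($e=1$); quadratic of Witt index $D$, $\dim U=2D$ ($e=0$); quadratic of Witt index $D$, $\dim U=2D+2$ ($e=2$); Hermitean, $\dim U=2D+1$, $b$ a square ($e=3/2$); Hermitean, $\dim U=2D$, $b$ a square ($e=1/2$). (The number $e$ should not be confused with the generator $e$ of $U_q(\mathfrak{sl}_2)$; it appears only in exponents $q^{\pm2e}$.) The dual polar graph $\Gamma$: vertices $X$ = maximal isotropic subspaces, $y\sim z$ iff $\dim(y\cap z)=D-1$, $\partial(y,z)=D-\dim(y\cap z)$. Let $q=\sqrt b>0$. $V=\mathbb{C}^X$, $A$ adjacency matrix, $\theta_0>\dots>\theta_D$ eigenvalues, $E_i$ orthogonal projection onto the $\theta_i$-eigenspace; fix $x\in X$, $E^*_i$ diagonal with $(y,y)$-entry $1$ if $\partial(x,y)=i$ else $0$, $A^*$ diagonal with $(y,y)$-entry $|X|(E_1)_{xy}$,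 $T$ generated by $A,A^*$. For irreducible $T$-module $W$: $r=\min\{i:E^*_iW\ne0\}$, $t=\min\{i:E_iW\ne0\}$, $d=|\{i:E^*_iW\ne0\}|-1$. $\Upsilon$ (resp. $\Psi$) is the central element of $T$ acting on the span of the irreducible $T$-modules with $r+t+d-D=\mu$ (resp. $r-t=\nu$) as $q^\mu I$ (resp. $q^\nu I$). $U_q(\mathfrak{sl}_2)$ has generators $x,y,z^{\pm1}$ with relations $zz^{-1}=z^{-1}z=1$, $\frac{qxy-q^{-1}yx}{q-q^{-1}}=\frac{qyz-q^{-1}zy}{q-q^{-1}}=\frac{qzx-q^{-1}xz}{q-q^{-1}}=1$, and elements $k^{\pm1}=z^{\pm1}$, $f=(q-q^{-1})^{-1}(x-z^{-1})$, $e=q^{-1}(q-q^{-1})^{-1}(1-zy)$ (these satisfy $ke=q^2ek$, $kf=q^{-2}fk$, $ef-fe=\frac{k-k^{-1}}{q-q^{-1}}$ and generate $U_q(\mathfrak{sl}_2)$). Put $h=\frac{1-q^{2e}}{q^2-1}$, $h^*=-\frac{b(b^{D+e-2}+1)}{b-1}$, $\kappa=\frac{q^{2e+D}}{q^2-1}$, $\kappa^*=\xi q^{-D}$ with $\xi=\frac{b^2(b^{D+e-2}+1)(b^{D+e-1}+1)}{(b-1)(b^e+b)}$, $\upsilon=-\frac{q^D}{q^2-1}$. The first module structure is the unique one with $A=h1+\kappa\Upsilon^{-1}\Psi x+\upsilon\Upsilon\Psi^{-1}y$, $A^*=h^*1+\kappa^*\Upsilon^{-1}\Psi^{-1}z$;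 the second is the unique one with $A=h1+\kappa\Upsilon^{-1}\Psi y+\upsilon\Upsilon\Psi^{-1}x$, $A^*=h^*1+\kappa^*\Upsilon^{-1}\Psi^{-1}z$. *)

theory Defs
  imports
    "HOL-Analysis.Analysis"
    "HOL-Algebra.QuotRing"
    "HOL-Library.Poly_Mapping"
begin

section \<open>Forms and dual polar graphs\<close>

text \<open>The finite field is the type \<open>'k\<close>, so \<open>b = CARD('k)\<close>; the space \<open>U\<close> is the type \<open>'u\<close>
  with scalar multiplication \<open>smul\<close>.\<close>

datatype ('k, 'u) polar_form =
    Symplectic "'u \<Rightarrow> 'u \<Rightarrow> 'k"
  | Quadratic "'u \<Rightarrow> 'k"
  | Hermitean "'u \<Rightarrow> 'u \<Rightarrow> 'k"

definition bilinear_form :: "('k::field \<Rightarrow> 'u::ab_group_add \<Rightarrow> 'u) \<Rightarrow> ('u \<Rightarrow> 'u \<Rightarrow> 'k) \<Rightarrow> bool" where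
  "bilinear_form smul B \<longleftrightarrow>
     (\<forall>u. Vector_Spaces.linear smul (*) (B u)) \<and>
     (\<forall>v. Vector_Spaces.linear smul (*) (\<lambda>u. B u v))"

definition nondegenerate_symplectic_form ::
    "('k::field \<Rightarrow> 'u::ab_group_add \<Rightarrow> 'u) \<Rightarrow> ('u \<Rightarrow> 'u \<Rightarrow> 'k) \<Rightarrow> bool" where
  "nondegenerate_symplectic_form smul B \<longleftrightarrow>
     bilinear_form smul B \<and> (\<forall>u. B u u = 0) \<and> (\<forall>u. (\<forall>v. B u v = 0) \<longrightarrow> u = 0)"

definition polarization :: "('u::ab_group_add \<Rightarrow> 'k::field) \<Rightarrow> 'u \<Rightarrow> 'u \<Rightarrow> 'k" where
  "polarization Q u v = Q (u + v) - Q u - Q v"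

text \<open>Nondegeneracy of a quadratic form means that no nonzero singular vector lies in the radical of
  its polarization. In characteristic 2 and odd dimension the radical itself is never zero.\<close>

definition nondegenerate_quadratic_form ::
    "('k::field \<Rightarrow> 'u::ab_group_add \<Rightarrow> 'u) \<Rightarrow> ('u \<Rightarrow> 'k) \<Rightarrow> bool" where
  "nondegenerate_quadratic_form smul Q \<longleftrightarrow>
     (\<forall>c u. Q (smul c u) = c\<^sup>2 * Q u) \<and> bilinear_form smul (polarization Q) \<and>
     (\<forall>u. Q u = 0 \<and> (\<forall>v. polarization Q u v = 0) \<longrightarrow> u = 0)"

text \<open>For a field with \<open>s\<^sup>2\<close> elements, \<open>c \<mapsto> c ^ s\<close> is the involutory field automorphism.\<close>

definition nondegenerate_hermitean_form ::
    "('k::field \<Rightarrow> 'u::ab_group_add \<Rightarrow> 'u) \<Rightarrow> nat \<Rightarrow> ('u \<Rightarrow> 'u \<Rightarrow> 'k) \<Rightarrow> bool" where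
  "nondegenerate_hermitean_form smul s H \<longleftrightarrow>
     (\<forall>v. Vector_Spaces.linear smul (*) (\<lambda>u. H u v)) \<and>
     (\<forall>u v. H v u = (H u v) ^ s) \<and> (\<forall>u. (\<forall>v. H u v = 0) \<longrightarrow> u = 0)"

fun vanishes_on :: "('k::field, 'u) polar_form \<Rightarrow> 'u set \<Rightarrow> bool" where
  "vanishes_on (Symplectic B) W \<longleftrightarrow> (\<forall>u\<in>W. \<forall>v\<in>W. B u v = 0)"
| "vanishes_on (Quadratic Q) W \<longleftrightarrow> (\<forall>u\<in>W. Q u = 0)"
| "vanishes_on (Hermitean H) W \<longleftrightarrow> (\<forall>u\<in>W. \<forall>v\<in>W. H u v = 0)"

definition isotropic_subspaces ::
    "('k::field \<Rightarrow> 'u::ab_group_add \<Rightarrow> 'u) \<Rightarrow> ('k, 'u) polar_form \<Rightarrow> 'u set set" where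
  "isotropic_subspaces smul F = {W. module.subspace smul W \<and> vanishes_on F W}"

definition maximal_isotropic_subspaces ::
    "('k::field \<Rightarrow> 'u::ab_group_add \<Rightarrow> 'u) \<Rightarrow> ('k, 'u) polar_form \<Rightarrow> 'u set set" where
  "maximal_isotropic_subspaces smul F =
     {W \<in> isotropic_subspaces smul F. \<forall>W' \<in> isotropic_subspaces smul F. W \<subseteq> W' \<longrightarrow> W' = W}"

definition witt_index ::
    "('k::field \<Rightarrow> 'u::ab_group_add \<Rightarrow> 'u) \<Rightarrow> ('k, 'u) polar_form \<Rightarrow> nat" where
  "witt_index smul F = Max (vector_space.dim smul ` isotropic_subspaces smul F)"

text \<open>The six families, with the parameter \<open>e\<close>. Since \<open>dim\<close> is 0 on infinite-dimensional spaces, the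
  dimension conditions (for \<open>D > 0\<close>) include finite-dimensionality.\<close>

definition dual_polar_type ::
    "('k::{field,finite} \<Rightarrow> 'u::ab_group_add \<Rightarrow> 'u) \<Rightarrow> ('k, 'u) polar_form \<Rightarrow> nat \<Rightarrow> real \<Rightarrow> bool" where
  "dual_polar_type smul F D e \<longleftrightarrow>
     (let n = vector_space.dim smul (UNIV :: 'u set) in
      case F of
        Symplectic B \<Rightarrow> nondegenerate_symplectic_form smul B \<and> n = 2 * D \<and> e = 1
      | Quadratic Q \<Rightarrow> nondegenerate_quadratic_form smul Q \<and>
          (n = 2 * D + 1 \<and> e = 1 \<or>
           n = 2 * D \<and> witt_index smul F = D \<and> e = 0 \<or>
           n = 2 * D + 2 \<and> witt_index smul F = D \<and> e = 2)
      | Hermitean H \<Rightarrow>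
          (\<exists>s. s\<^sup>2 = CARD('k) \<and> nondegenerate_hermitean_form smul s H) \<and>
          (n = 2 * D + 1 \<and> e = 3/2 \<or> n = 2 * D \<and> e = 1/2))"

text \<open>In what follows \<open>vert\<close> is a bijection from a finite index type \<open>'x\<close> onto the vertex set \<open>X\<close> of the
  dual polar graph; this identifies \<open>\<complex>\<^sup>X\<close> with \<open>complex ^ 'x\<close> and the endomorphisms of \<open>\<complex>\<^sup>X\<close> with
  matrices. The scalar multiple \<open>c M\<close> of a matrix is written \<open>mat c ** M\<close>.\<close>

definition adjacency_matrix ::
    "('k::field \<Rightarrow> 'u::ab_group_add \<Rightarrow> 'u) \<Rightarrow> nat \<Rightarrow> ('x::finite \<Rightarrow> 'u set) \<Rightarrow> complex^'x^'x" where
  "adjacency_matrix smul D vert =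
     (\<chi> y z. if vector_space.dim smul (vert y \<inter> vert z) = D - 1 then 1 else 0)"

definition graph_dist ::
    "('k::field \<Rightarrow> 'u::ab_group_add \<Rightarrow> 'u) \<Rightarrow> nat \<Rightarrow> ('x::finite \<Rightarrow> 'u set) \<Rightarrow> 'x \<Rightarrow> 'x \<Rightarrow> nat" where
  "graph_dist smul D vert y z = D - vector_space.dim smul (vert y \<inter> vert z)"

definition eigenspace :: "complex^'x^'x \<Rightarrow> complex \<Rightarrow> (complex^'x) set" where
  "eigenspace M c = {v. M *v v = c *s v}"

text \<open>The \<open>i\<close>-th largest real eigenvalue, counting from 0 and without multiplicity (the adjacency
  matrix is real symmetric, so all its eigenvalues are real).\<close>

definition nth_eigenvalue :: "complex^'x^'x \<Rightarrow> nat \<Rightarrow> real" where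
  "nth_eigenvalue M i =
     rev (sorted_list_of_set {c :: real. eigenspace M (complex_of_real c) \<noteq> {0}}) ! i"

definition conj_transpose :: "complex^'x^'x \<Rightarrow> complex^'x^'x" where
  "conj_transpose M = (\<chi> y z. cnj (M $ z $ y))"

definition orthogonal_projection :: "(complex^'x::finite) set \<Rightarrow> complex^'x^'x" where
  "orthogonal_projection S =
     (THE P. P ** P = P \<and> conj_transpose P = P \<and> range ((*v) P) = S)"

definition eigenprojection :: "complex^'x::finite^'x \<Rightarrow> nat \<Rightarrow> complex^'x^'x" where
  "eigenprojection A i = orthogonal_projection (eigenspace A (of_real (nth_eigenvalue A i)))"

definition dual_idempotent ::
    "('k::field \<Rightarrow> 'u::ab_group_add \<Rightarrow> 'u) \<Rightarrow> nat \<Rightarrow> ('x::finite \<Rightarrow> 'u set) \<Rightarrow> 'x \<Rightarrow> nat \<Rightarrow> complex^'x^'x" where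
  "dual_idempotent smul D vert x i =
     (\<chi> y z. if y = z \<and> graph_dist smul D vert x y = i then 1 else 0)"

definition dual_adjacency_matrix :: "complex^'x::finite^'x \<Rightarrow> 'x \<Rightarrow> complex^'x^'x" where
  "dual_adjacency_matrix A x =
     (\<chi> y z. if y = z then of_nat CARD('x) * eigenprojection A 1 $ x $ y else 0)"

section \<open>The subconstituent algebra and its modules\<close>

inductive_set generated_algebra :: "(complex^'x::finite^'x) set \<Rightarrow> (complex^'x^'x) set"
  for G :: "(complex^'x::finite^'x) set" where
  "M \<in> G \<Longrightarrow> M \<in> generated_algebra G"
| "mat c \<in> generated_algebra G"
| "M \<in> generated_algebra G \<Longrightarrow> N \<in> generated_algebra G \<Longrightarrow> M + N \<in> generated_algebra G"
| "M \<in> generated_algebra G \<Longrightarrow> N \<in> generated_algebra G \<Longrightarrow> M ** N \<in> generated_algebra G"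

definition center_of :: "(complex^'x::finite^'x) set \<Rightarrow> (complex^'x^'x) set" where
  "center_of T = {M \<in> T. \<forall>N\<in>T. M ** N = N ** M}"

definition submodule_of :: "(complex^'x::finite^'x) set \<Rightarrow> (complex^'x) set \<Rightarrow> bool" where
  "submodule_of T W \<longleftrightarrow> vec.subspace W \<and> (\<forall>M\<in>T. \<forall>w\<in>W. M *v w \<in> W)"

definition irreducible_submodule_of :: "(complex^'x::finite^'x) set \<Rightarrow> (complex^'x) set \<Rightarrow> bool" where
  "irreducible_submodule_of T W \<longleftrightarrow>
     submodule_of T W \<and> W \<noteq> {0} \<and> (\<forall>W'. submodule_of T W' \<and> W' \<subseteq> W \<longrightarrow> W' = {0} \<or> W' = W)"

text \<open>Below, \<open>E\<close> is a family of idempotents indexed by \<open>0, \<dots>, D\<close>.\<close>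

definition support_indices ::
    "nat \<Rightarrow> (nat \<Rightarrow> complex^'x::finite^'x) \<Rightarrow> (complex^'x) set \<Rightarrow> nat set" where
  "support_indices D E W = {i. i \<le> D \<and> (*v) (E i) ` W \<noteq> {0}}"

definition endpoint ::
    "nat \<Rightarrow> (nat \<Rightarrow> complex^'x::finite^'x) \<Rightarrow> (complex^'x) set \<Rightarrow> nat" where
  "endpoint D E W = Min (support_indices D E W)"

definition module_diam ::
    "nat \<Rightarrow> (nat \<Rightarrow> complex^'x::finite^'x) \<Rightarrow> (complex^'x) set \<Rightarrow> nat" where
  "module_diam D E W = card (support_indices D E W) - 1"

text \<open>\<open>acts_by_power T q \<phi> C\<close>: the element \<open>C\<close> of the center of \<open>T\<close> acts as \<open>q\<^sup>\<mu>\<close> on the span of the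
  irreducible \<open>T\<close>-modules \<open>W\<close> with \<open>\<phi> W = \<mu>\<close>. There is exactly one such \<open>C\<close> when \<open>\<phi>\<close> is invariant under
  isomorphism and \<open>\<complex>\<^sup>X\<close> is completely reducible.\<close>

definition acts_by_power ::
    "(complex^'x::finite^'x) set \<Rightarrow> real \<Rightarrow> ((complex^'x) set \<Rightarrow> int) \<Rightarrow> complex^'x^'x \<Rightarrow> bool" where
  "acts_by_power T q \<phi> C \<longleftrightarrow> C \<in> center_of T \<and>
     (\<forall>\<mu>. \<forall>v \<in> vec.span (\<Union>{W. irreducible_submodule_of T W \<and> \<phi> W = \<mu>}).
        C *v v = of_real (q powi \<mu>) *s v)"

text \<open>The arguments \<open>E\<close> and \<open>Es\<close> are the families \<open>E\<^sub>i\<close> and \<open>E\<^sup>*\<^sub>i\<close>.\<close>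

definition is_Upsilon ::
    "(complex^'x::finite^'x) set \<Rightarrow> real \<Rightarrow> nat \<Rightarrow> (nat \<Rightarrow> complex^'x^'x) \<Rightarrow> (nat \<Rightarrow> complex^'x^'x) \<Rightarrow>
     complex^'x^'x \<Rightarrow> bool" where
  "is_Upsilon T q D E Es =
     acts_by_power T q (\<lambda>W. int (endpoint D Es W) + int (endpoint D E W) + int (module_diam D Es W) - int D)"

definition is_Psi ::
    "(complex^'x::finite^'x) set \<Rightarrow> real \<Rightarrow> nat \<Rightarrow> (nat \<Rightarrow> complex^'x^'x) \<Rightarrow> (nat \<Rightarrow> complex^'x^'x) \<Rightarrow>
     complex^'x^'x \<Rightarrow> bool" where
  "is_Psi T q D E Es = acts_by_power T q (\<lambda>W. int (endpoint D Es W) - int (endpoint D E W))"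

section \<open>The algebra \<open>U\<^sub>q(sl\<^sub>2)\<close> in the equitable presentation\<close>

text \<open>\<open>uq_word\<close> is the free monoid (written additively, as required for the convolution product on
  \<open>poly_mapping\<close>) on the four generators, so \<open>free_uq\<close> is the free associative algebra on them.\<close>

datatype uq_gen = GX | GY | GZ | GZinv

datatype uq_word = Word (letters: "uq_gen list")

instantiation uq_word :: monoid_add
begin

definition zero_uq_word :: uq_word where
  "zero_uq_word = Word []"

definition plus_uq_word :: "uq_word \<Rightarrow> uq_word \<Rightarrow> uq_word" where
  "plus_uq_word v w = Word (letters v @ letters w)"

instance
  by standard (simp_all add: zero_uq_word_def plus_uq_word_def)

end

type_synonym free_uq = "uq_word \<Rightarrow>\<^sub>0 complex"

definition gen :: "uq_gen \<Rightarrow> free_uq" where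
  "gen g = Poly_Mapping.single (Word [g]) 1"

definition scalar :: "complex \<Rightarrow> free_uq" where
  "scalar c = Poly_Mapping.single 0 c"

definition free_uq_ring :: "free_uq ring" where
  "free_uq_ring = \<lparr>carrier = UNIV, monoid.mult = (*), one = 1, ring.zero = 0, add = (+)\<rparr>"

definition q_comm :: "complex \<Rightarrow> free_uq \<Rightarrow> free_uq \<Rightarrow> free_uq" where
  "q_comm q u v = scalar (inverse (q - inverse q)) * (scalar q * u * v - scalar (inverse q) * v * u)"

definition uq_relators :: "complex \<Rightarrow> free_uq set" where
  "uq_relators q =
     {gen GZ * gen GZinv - 1,
      gen GZinv * gen GZ - 1,
      q_comm q (gen GX) (gen GY) - 1,
      q_comm q (gen GY) (gen GZ) - 1,
      q_comm q (gen GZ) (gen GX) - 1}"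

definition uq_ideal :: "complex \<Rightarrow> free_uq set" where
  "uq_ideal q = genideal free_uq_ring (uq_relators q)"

definition Uq :: "complex \<Rightarrow> free_uq set ring" where
  "Uq q = FactRing free_uq_ring (uq_ideal q)"

definition uq_class :: "complex \<Rightarrow> free_uq \<Rightarrow> free_uq set" where
  "uq_class q p = a_r_coset free_uq_ring (uq_ideal q) p"

definition uq_x :: "complex \<Rightarrow> free_uq set" where
  "uq_x q = uq_class q (gen GX)"

definition uq_y :: "complex \<Rightarrow> free_uq set" where
  "uq_y q = uq_class q (gen GY)"

definition uq_z :: "complex \<Rightarrow> free_uq set" where
  "uq_z q = uq_class q (gen GZ)"

definition uq_k :: "complex \<Rightarrow> free_uq set" where
  "uq_k q = uq_z q"

definition uq_f :: "complex \<Rightarrow> free_uq set" where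
  "uq_f q = uq_class q (scalar (inverse (q - inverse q)) * (gen GX - gen GZinv))"

definition uq_e :: "complex \<Rightarrow> free_uq set" where
  "uq_e q = uq_class q (scalar (inverse q * inverse (q - inverse q)) * (1 - gen GZ * gen GY))"

definition matrix_ring :: "(complex^'x::finite^'x) ring" where
  "matrix_ring = \<lparr>carrier = UNIV, monoid.mult = (**), one = mat 1, ring.zero = 0, add = (+)\<rparr>"

definition uq_representation :: "complex \<Rightarrow> (free_uq set \<Rightarrow> complex^'x::finite^'x) \<Rightarrow> bool" where
  "uq_representation q \<pi> \<longleftrightarrow>
     \<pi> \<in> ring_hom (Uq q) matrix_ring \<and>
     (\<forall>c p. \<pi> (uq_class q (scalar c * p)) = mat c ** \<pi> (uq_class q p))"

section \<open>The two module structures\<close>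

definition param_h :: "real \<Rightarrow> real \<Rightarrow> real" where
  "param_h q e = (1 - q powr (2 * e)) / (q\<^sup>2 - 1)"

definition param_h_star :: "real \<Rightarrow> nat \<Rightarrow> real \<Rightarrow> real" where
  "param_h_star b D e = - (b * (b powr (real D + e - 2) + 1) / (b - 1))"

definition param_kappa :: "real \<Rightarrow> nat \<Rightarrow> real \<Rightarrow> real" where
  "param_kappa q D e = q powr (2 * e + real D) / (q\<^sup>2 - 1)"

definition param_xi :: "real \<Rightarrow> nat \<Rightarrow> real \<Rightarrow> real" where
  "param_xi b D e =
     b\<^sup>2 * (b powr (real D + e - 2) + 1) * (b powr (real D + e - 1) + 1) / ((b - 1) * (b powr e + b))"

definition param_kappa_star :: "real \<Rightarrow> real \<Rightarrow> nat \<Rightarrow> real \<Rightarrow> real" where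
  "param_kappa_star b q D e = param_xi b D e * q powr (- real D)"

definition param_upsilon :: "real \<Rightarrow> nat \<Rightarrow> real" where
  "param_upsilon q D = - (q ^ D / (q\<^sup>2 - 1))"

definition cmat :: "real \<Rightarrow> complex^'x::finite^'x" where
  "cmat c = mat (complex_of_real c)"

definition dual_adjacency_equation ::
    "real \<Rightarrow> real \<Rightarrow> nat \<Rightarrow> real \<Rightarrow> complex^'x::finite^'x \<Rightarrow> complex^'x^'x \<Rightarrow> complex^'x^'x \<Rightarrow>
     (free_uq set \<Rightarrow> complex^'x^'x) \<Rightarrow> bool" where
  "dual_adjacency_equation b q D e As \<Upsilon> \<Psi> \<pi> \<longleftrightarrow>
     As = cmat (param_h_star b D e)
        + cmat (param_kappa_star b q D e) ** matrix_inv \<Upsilon> ** matrix_inv \<Psi> ** \<pi> (uq_z (of_real q))"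

definition first_module_structure ::
    "real \<Rightarrow> real \<Rightarrow> nat \<Rightarrow> real \<Rightarrow> complex^'x::finite^'x \<Rightarrow> complex^'x^'x \<Rightarrow> complex^'x^'x \<Rightarrow>
     complex^'x^'x \<Rightarrow> (free_uq set \<Rightarrow> complex^'x^'x) \<Rightarrow> bool" where
  "first_module_structure b q D e A As \<Upsilon> \<Psi> \<pi> \<longleftrightarrow>
     uq_representation (of_real q) \<pi> \<and>
     A = cmat (param_h q e)
       + cmat (param_kappa q D e) ** matrix_inv \<Upsilon> ** \<Psi> ** \<pi> (uq_x (of_real q))
       + cmat (param_upsilon q D) ** \<Upsilon> ** matrix_inv \<Psi> ** \<pi> (uq_y (of_real q)) \<and>
     dual_adjacency_equation b q D e As \<Upsilon> \<Psi> \<pi>"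

definition second_module_structure ::
    "real \<Rightarrow> real \<Rightarrow> nat \<Rightarrow> real \<Rightarrow> complex^'x::finite^'x \<Rightarrow> complex^'x^'x \<Rightarrow> complex^'x^'x \<Rightarrow>
     complex^'x^'x \<Rightarrow> (free_uq set \<Rightarrow> complex^'x^'x) \<Rightarrow> bool" where
  "second_module_structure b q D e A As \<Upsilon> \<Psi> \<pi> \<longleftrightarrow>
     uq_representation (of_real q) \<pi> \<and>
     A = cmat (param_h q e)
       + cmat (param_kappa q D e) ** matrix_inv \<Upsilon> ** \<Psi> ** \<pi> (uq_y (of_real q))
       + cmat (param_upsilon q D) ** \<Upsilon> ** matrix_inv \<Psi> ** \<pi> (uq_x (of_real q)) \<and>
     dual_adjacency_equation b q D e As \<Upsilon> \<Psi> \<pi>"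

end

theory Submission
  imports Defs
begin

text \<open>The equitable relation for \<open>u\<close>, \<open>v\<close> says \<open>1 - uv = q\<^sup>-\<^sup>2(1 - vu)\<close>. Hence conjugation by \<open>z\<close>
  multiplies \<open>x - z\<^sup>-\<^sup>1\<close>, a multiple of \<open>f\<close>, by \<open>q\<^sup>-\<^sup>2\<close> and \<open>y - z\<^sup>-\<^sup>1\<close>, a multiple of \<open>z\<^sup>-\<^sup>1e\<close>, by \<open>q\<^sup>2\<close>. Both
  module structures have the same \<open>z\<close>, which is determined by \<open>A\<^sup>*\<close>, \<open>\<Upsilon>\<close> and \<open>\<Psi>\<close> and therefore lies in
  \<open>T\<close> and commutes with the central elements \<open>\<Upsilon>\<close> and \<open>\<Psi>\<close>. Comparing the two weight components of
  the two expressions for \<open>A\<close> yields the formulas for \<open>e\<close> and \<open>f\<close>. The elements \<open>\<Upsilon>\<close> and \<open>\<Psi>\<close> are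
  invertible because the kernel of a central element is a \<open>T\<close>-module, and an irreducible submodule of
  it would be acted on by a power of \<open>q\<close>.\<close>

section \<open>Matrices\<close>

lemma mat_nth: "mat c $ i $ j = (if i = j then c else 0)"
  by (simp add: mat_def)

lemma mat_mult_nth [simp]: "(mat c ** M) $ i $ j = c * M $ i $ j"
  for M :: "'a::semiring_1^'n^'m::finite"
  by (simp add: matrix_matrix_mult_def mat_def if_distrib if_distribR cong: if_cong)

lemma mat_mult_mat: "mat c ** mat d = (mat (c * d) :: 'a::semiring_1^'n::finite^'n)"
  by (simp add: vec_eq_iff mat_nth)

lemma mat_mult_commute: "M ** mat c = mat c ** M"
  for M :: "'a::comm_semiring_1^'n::finite^'n"
  by (simp add: vec_eq_iff)
    (simp add: matrix_matrix_mult_def mat_def if_distrib if_distribR mult.commute cong: if_cong)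

lemma mult_mat_mult: "M ** (mat c ** N) = mat c ** (M ** N)"
  for M :: "'a::comm_semiring_1^'n::finite^'n"
  by (simp add: matrix_mul_assoc mat_mult_commute[of M])

lemma matrix_diff_ldistrib: "M ** (N - P) = M ** N - M ** P"
  for M :: "'a::ring_1^'n::finite^'m"
  by (simp add: vec_eq_iff matrix_matrix_mult_def right_diff_distrib sum_subtractf)

lemma matrix_diff_rdistrib: "(N - P) ** M = N ** M - P ** M"
  for M :: "'a::ring_1^'k^'n::finite"
  by (simp add: vec_eq_iff matrix_matrix_mult_def left_diff_distrib sum_subtractf)

lemma matrix_mult_interchange:
  fixes M N P Q :: "'a::semiring_1^'n::finite^'n"
  assumes "N ** P = P ** N"
  shows "M ** N ** (P ** Q) = M ** P ** (N ** Q)"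
proof -
  have "M ** N ** (P ** Q) = M ** (N ** P) ** Q"
    by (simp add: matrix_mul_assoc)
  also have "\<dots> = M ** P ** (N ** Q)"
    by (simp add: assms matrix_mul_assoc)
  finally show ?thesis .
qed

lemma
  fixes M :: "'a::semiring_1^'n::finite^'n"
  assumes "invertible M"
  shows matrix_inv_left: "matrix_inv M ** M = mat 1"
    and matrix_inv_right: "M ** matrix_inv M = mat 1"
proof -
  have "M ** matrix_inv M = mat 1 \<and> matrix_inv M ** M = mat 1"
    using assms unfolding invertible_def matrix_inv_def by (rule someI_ex)
  then show "matrix_inv M ** M = mat 1" "M ** matrix_inv M = mat 1"
    by simp_all
qed

lemma matrix_inv_unique:
  fixes M N :: "'a::field^'n::finite^'n"
  assumes "M ** N = mat 1"
  shows "matrix_inv M = N"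
proof -
  have "invertible M"
    using assms invertible_right_inverse by blast
  then have "matrix_inv M ** (M ** N) = N"
    by (simp add: matrix_mul_assoc matrix_inv_left)
  then show ?thesis
    by (simp add: assms)
qed

lemma matrix_inv_commute:
  fixes M N :: "'a::semiring_1^'n::finite^'n"
  assumes "invertible M" "M ** N = N ** M"
  shows "matrix_inv M ** N = N ** matrix_inv M"
proof -
  have "matrix_inv M ** N = matrix_inv M ** (N ** M) ** matrix_inv M"
    by (simp add: matrix_inv_right[OF assms(1)] flip: matrix_mul_assoc)
  also have "\<dots> = (matrix_inv M ** M) ** N ** matrix_inv M"
    by (simp add: assms(2)[symmetric] matrix_mul_assoc)
  finally show ?thesis
    by (simp add: matrix_inv_left[OF assms(1)])
qed

lemma
  fixes M N :: "'a::semiring_1^'n::finite^'n"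
  assumes inv: "invertible M" "invertible N" and "M ** N = N ** M"
  shows commuting_quotient_mult_inverse: "M ** matrix_inv N ** (matrix_inv M ** N) = mat 1"
    and commuting_quotient_square:
      "M ** matrix_inv N ** (M ** matrix_inv N) = M ** M ** (matrix_inv N ** matrix_inv N)"
    and commuting_quotient_inverse_square:
      "matrix_inv M ** N ** (matrix_inv M ** N) = matrix_inv M ** matrix_inv M ** (N ** N)"
proof -
  have N_inv_M: "matrix_inv N ** M = M ** matrix_inv N"
    by (rule matrix_inv_commute) (simp_all add: assms)
  have N_M_inv: "N ** matrix_inv M = matrix_inv M ** N"
    by (rule matrix_inv_commute[symmetric]) (simp_all add: assms)
  have "matrix_inv N ** matrix_inv M = matrix_inv M ** matrix_inv N"
    by (rule matrix_inv_commute) (simp_all add: inv N_M_inv)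
  then have "M ** matrix_inv N ** (matrix_inv M ** N) = M ** matrix_inv M ** (matrix_inv N ** N)"
    by (rule matrix_mult_interchange)
  then show "M ** matrix_inv N ** (matrix_inv M ** N) = mat 1"
    by (simp add: matrix_inv_left matrix_inv_right inv)
  show "M ** matrix_inv N ** (M ** matrix_inv N) = M ** M ** (matrix_inv N ** matrix_inv N)"
    by (rule matrix_mult_interchange[OF N_inv_M])
  show "matrix_inv M ** N ** (matrix_inv M ** N) = matrix_inv M ** matrix_inv M ** (N ** N)"
    by (rule matrix_mult_interchange[OF N_M_inv])
qed

lemma eq_if_mult_eq_inverse_mult:
  fixes M N P P' :: "'a::field^'n::finite^'n"
  assumes "mat a ** P ** M = mat b ** P' ** N" "P' ** P = mat 1" "a \<noteq> 0"
  shows "M = mat (b / a) ** (P' ** P') ** N"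
proof -
  have "P' ** (P ** M) = M"
    by (simp add: matrix_mul_assoc assms(2))
  then have "mat a ** M = P' ** (mat a ** P ** M)"
    by (simp add: mult_mat_mult flip: matrix_mul_assoc)
  also have "\<dots> = P' ** (mat b ** P' ** N)"
    by (simp only: assms(1))
  also have "\<dots> = mat b ** (P' ** P' ** N)"
    by (simp add: mult_mat_mult flip: matrix_mul_assoc)
  finally show ?thesis
    using assms(3) by (simp add: vec_eq_iff field_simps flip: matrix_mul_assoc)
qed

section \<open>Weight spaces of conjugation\<close>

definition weight_space :: "'a::semiring_1^'n::finite^'n \<Rightarrow> 'a \<Rightarrow> ('a^'n^'n) set" where
  "weight_space Z c = {M. Z ** M = mat c ** (M ** Z)}"

lemma weight_space_one_iff: "M \<in> weight_space Z 1 \<longleftrightarrow> Z ** M = M ** Z"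
  by (simp add: weight_space_def)

lemma weight_space_diff:
  fixes Z :: "'a::ring_1^'n::finite^'n"
  assumes "M \<in> weight_space Z c" "N \<in> weight_space Z c"
  shows "M - N \<in> weight_space Z c"
  using assms by (simp add: weight_space_def matrix_diff_ldistrib matrix_diff_rdistrib)

lemma weight_space_mult:
  fixes Z :: "'a::comm_semiring_1^'n::finite^'n"
  assumes "M \<in> weight_space Z c" "N \<in> weight_space Z d"
  shows "M ** N \<in> weight_space Z (c * d)"
proof -
  have "Z ** (M ** N) = mat c ** M ** (Z ** N)"
    using assms(1) by (simp add: weight_space_def matrix_mul_assoc)
  also have "\<dots> = mat c ** (mat d ** (M ** N ** Z))"
    using assms(2) by (simp add: weight_space_def mult_mat_mult[of M] flip: matrix_mul_assoc)
  finally show ?thesis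
    by (simp add: weight_space_def mat_mult_mat matrix_mul_assoc)
qed

lemma weight_space_commuting_mult:
  fixes Z :: "'a::comm_semiring_1^'n::finite^'n"
  assumes "Z ** C = C ** Z" "M \<in> weight_space Z c"
  shows "mat a ** C ** M \<in> weight_space Z c"
proof -
  have "mat a \<in> weight_space Z 1" "C \<in> weight_space Z 1"
    by (simp_all add: weight_space_one_iff mat_mult_commute assms(1))
  then have "mat a ** C ** M \<in> weight_space Z (1 * 1 * c)"
    by (intro weight_space_mult assms(2))
  then show ?thesis
    by simp
qed

lemma weight_space_distinct_eq_zero:
  fixes Z :: "'a::field^'n::finite^'n"
  assumes "invertible Z" "c \<noteq> d" "M \<in> weight_space Z c" "M \<in> weight_space Z d"
  shows "M = 0"
proof -
  have "mat c ** (M ** Z) = mat d ** (M ** Z)"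
    using assms(3,4) by (simp add: weight_space_def)
  then have "M ** Z = 0"
    using assms(2) by (simp add: vec_eq_iff)
  then have "M ** (Z ** matrix_inv Z) = 0"
    by (simp add: matrix_mul_assoc)
  then show ?thesis
    by (simp add: matrix_inv_right[OF assms(1)])
qed

lemma weight_components_unique:
  fixes Z :: "'a::field^'n::finite^'n"
  assumes "invertible Z" "c \<noteq> d"
    and "M \<in> weight_space Z c" "M' \<in> weight_space Z c"
    and "N \<in> weight_space Z d" "N' \<in> weight_space Z d"
    and "M + N = M' + N'"
  shows "M = M'" "N = N'"
proof -
  have "M - M' = N' - N"
    using assms(7) by (simp add: algebra_simps)
  moreover have "M - M' \<in> weight_space Z c" "N' - N \<in> weight_space Z d"
    by (intro weight_space_diff assms(3-6))+
  ultimately have "M - M' = 0"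
    using weight_space_distinct_eq_zero[OF assms(1,2)] by metis
  with \<open>M - M' = N' - N\<close> show "M = M'" "N = N'"
    by simp_all
qed

lemma weight_components_exchange:
  fixes Z P P' :: "'a::field^'n::finite^'n"
  assumes "invertible Z" "c \<noteq> d"
    and F: "F\<^sub>1 \<in> weight_space Z c" "F\<^sub>2 \<in> weight_space Z c"
    and G: "G\<^sub>1 \<in> weight_space Z d" "G\<^sub>2 \<in> weight_space Z d"
    and P: "Z ** P = P ** Z" "P ** P' = mat 1"
    and "\<kappa> \<noteq> 0" "\<upsilon> \<noteq> 0"
    and sum: "mat \<kappa> ** P' ** F\<^sub>1 + mat \<upsilon> ** P ** G\<^sub>1 = mat \<kappa> ** P' ** G\<^sub>2 + mat \<upsilon> ** P ** F\<^sub>2"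
  shows "F\<^sub>2 = mat (\<kappa> / \<upsilon>) ** (P' ** P') ** F\<^sub>1"
    and "G\<^sub>2 = mat (\<upsilon> / \<kappa>) ** (P ** P) ** G\<^sub>1"
proof -
  have "P' ** P = mat 1"
    using P(2) matrix_left_right_inverse by blast
  have "invertible P" "matrix_inv P = P'"
    using P(2) invertible_right_inverse matrix_inv_unique by blast+
  then have P': "Z ** P' = P' ** Z"
    using matrix_inv_commute P(1) by metis
  have "mat \<kappa> ** P' ** F\<^sub>1 + mat \<upsilon> ** P ** G\<^sub>1 = mat \<upsilon> ** P ** F\<^sub>2 + mat \<kappa> ** P' ** G\<^sub>2"
    using sum by (simp add: add.commute)
  note components = weight_components_unique[OF \<open>invertible Z\<close> \<open>c \<noteq> d\<close>
      weight_space_commuting_mult[OF P' F(1)] weight_space_commuting_mult[OF P(1) F(2)]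
      weight_space_commuting_mult[OF P(1) G(1)] weight_space_commuting_mult[OF P' G(2)] this]
  show "F\<^sub>2 = mat (\<kappa> / \<upsilon>) ** (P' ** P') ** F\<^sub>1"
    and "G\<^sub>2 = mat (\<upsilon> / \<kappa>) ** (P ** P) ** G\<^sub>1"
    using eq_if_mult_eq_inverse_mult[OF components(1)[symmetric] \<open>P' ** P = mat 1\<close> \<open>\<upsilon> \<noteq> 0\<close>]
      eq_if_mult_eq_inverse_mult[OF components(2)[symmetric] P(2) \<open>\<kappa> \<noteq> 0\<close>] by simp_all
qed

section \<open>Central elements of a matrix algebra\<close>

lemma generated_algebra_diff:
  assumes "M \<in> generated_algebra G" "N \<in> generated_algebra G"
  shows "M - N \<in> generated_algebra G"
proof -
  have "M - N = M + mat (- 1) ** N"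
    by (simp add: vec_eq_iff)
  also have "\<dots> \<in> generated_algebra G"
    by (intro generated_algebra.intros assms)
  finally show ?thesis .
qed

lemma submodule_contains_irreducible:
  assumes "submodule_of T W" "W \<noteq> {0}"
  obtains W' where "irreducible_submodule_of T W'" "W' \<subseteq> W"
proof -
  have "\<exists>W'. irreducible_submodule_of T W' \<and> W' \<subseteq> W"
    using assms
  proof (induction "vec.dim W" arbitrary: W rule: less_induct)
    case less
    show ?case
    proof (cases "irreducible_submodule_of T W")
      case False
      then obtain W' where W': "submodule_of T W'" "W' \<subseteq> W" "W' \<noteq> {0}" "W' \<noteq> W"
        using less.prems unfolding irreducible_submodule_of_def by blast
      then have "vec.dim W' < vec.dim W"
        using less.prems vec.subspace_dim_equal[of W' W]
        unfolding submodule_of_def by (metis not_le)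
      then show ?thesis
        using less.hyps W' by (meson subset_trans)
    qed blast
  qed
  then show ?thesis
    using that by blast
qed

lemma kernel_central_submodule:
  assumes "C \<in> center_of T"
  shows "submodule_of T {v. C *v v = 0}"
proof -
  have "C *v (M *v w) = 0" if "M \<in> T" "C *v w = 0" for M w
  proof -
    have "C *v (M *v w) = M *v (C *v w)"
      using assms that(1) by (simp add: center_of_def matrix_vector_mul_assoc)
    then show ?thesis
      by (simp add: that(2))
  qed
  then show ?thesis
    by (auto simp: submodule_of_def vec.subspace_def matrix_vector_right_distrib vec.scale)
qed

lemma central_invertible_if_injective_on_irreducibles:
  assumes "C \<in> center_of T"
    and inj: "\<And>W w. irreducible_submodule_of T W \<Longrightarrow> w \<in> W \<Longrightarrow> C *v w = 0 \<Longrightarrow> w = 0"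
  shows "invertible C"
proof (rule ccontr)
  let ?K = "{v. C *v v = 0}"
  assume "\<not> invertible C"
  then have "?K \<noteq> {0}"
    unfolding invertible_left_inverse matrix_left_invertible_ker by blast
  then obtain W where W: "irreducible_submodule_of T W" "W \<subseteq> ?K"
    using submodule_contains_irreducible kernel_central_submodule[OF assms(1)] by blast
  then have "0 \<in> W" "W \<noteq> {0}"
    unfolding irreducible_submodule_of_def submodule_of_def by (simp_all add: vec.subspace_0)
  then show False
    using W inj by blast
qed

lemma acts_by_power_invertible:
  assumes "acts_by_power T q \<phi> C" "q \<noteq> 0"
  shows "invertible C"
proof (rule central_invertible_if_injective_on_irreducibles)
  show "C \<in> center_of T"
    using assms(1) by (simp add: acts_by_power_def)
next
  fix W w
  assume W: "irreducible_submodule_of T W" "w \<in> W" and "C *v w = 0"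
  have "w \<in> vec.span (\<Union>{W'. irreducible_submodule_of T W' \<and> \<phi> W' = \<phi> W})"
    using W by (intro vec.span_base) blast
  then have "C *v w = of_real (q powi \<phi> W) *s w"
    using assms(1) by (simp add: acts_by_power_def)
  then show "w = 0"
    using \<open>C *v w = 0\<close> assms(2) by (metis of_real_eq_0_iff power_int_not_zero vector_mul_eq_0)
qed

section \<open>Representations of \<open>U\<^sub>q(sl\<^sub>2)\<close>\<close>

lemma ring_free_uq_ring: "ring free_uq_ring"
proof (rule ringI)
  show "abelian_group free_uq_ring"
  proof (rule abelian_groupI)
    fix p assume "p \<in> carrier free_uq_ring"
    show "\<exists>p'\<in>carrier free_uq_ring. p' \<oplus>\<^bsub>free_uq_ring\<^esub> p = \<zero>\<^bsub>free_uq_ring\<^esub>"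
      by (rule bexI[of _ "- p"]) (simp_all add: free_uq_ring_def)
  qed (simp_all add: free_uq_ring_def add_ac)
  show "Group.monoid free_uq_ring"
    by (rule Group.monoidI) (simp_all add: free_uq_ring_def mult.assoc)
qed (simp_all add: free_uq_ring_def distrib_left distrib_right)

lemma ideal_uq_ideal: "ideal (uq_ideal q) free_uq_ring"
  unfolding uq_ideal_def
  by (rule ring.genideal_ideal[OF ring_free_uq_ring]) (simp add: free_uq_ring_def)

lemma uq_class_hom: "uq_class q \<in> ring_hom free_uq_ring (Uq q)"
  using ideal.rcos_ring_hom[OF ideal_uq_ideal, of q] by (simp add: Uq_def uq_class_def[abs_def])

lemma uq_class_relator:
  assumes "p \<in> uq_relators q"
  shows "uq_class q p = uq_class q 0"
proof -
  have "p \<in> uq_ideal q"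
    using assms ring.genideal_self[OF ring_free_uq_ring, of "uq_relators q"]
    by (auto simp: uq_ideal_def free_uq_ring_def)
  moreover have "0 \<in> uq_ideal q"
    using additive_subgroup.zero_closed[OF ideal.axioms(1)[OF ideal_uq_ideal]]
    by (simp add: free_uq_ring_def)
  ultimately show ?thesis
    by (simp add: uq_class_def ring.a_rcos_zero[OF ring_free_uq_ring ideal_uq_ideal])
qed

context
  fixes q :: complex and \<pi> :: "free_uq set \<Rightarrow> complex^'x::finite^'x"
  assumes \<pi>: "uq_representation q \<pi>"
begin

lemma uq_representation_hom:
  "\<pi> (uq_class q (p + p')) = \<pi> (uq_class q p) + \<pi> (uq_class q p')"
  "\<pi> (uq_class q (p * p')) = \<pi> (uq_class q p) ** \<pi> (uq_class q p')"
  "\<pi> (uq_class q 1) = mat 1"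
proof -
  have "\<pi> \<circ> uq_class q \<in> ring_hom free_uq_ring matrix_ring"
    using \<pi> uq_class_hom by (auto simp: uq_representation_def intro: ring_hom_trans)
  then show "\<pi> (uq_class q (p + p')) = \<pi> (uq_class q p) + \<pi> (uq_class q p')"
    "\<pi> (uq_class q (p * p')) = \<pi> (uq_class q p) ** \<pi> (uq_class q p')"
    "\<pi> (uq_class q 1) = mat 1"
    by (auto simp: ring_hom_def free_uq_ring_def matrix_ring_def)
qed

lemma uq_representation_diff:
  "\<pi> (uq_class q (p - p')) = \<pi> (uq_class q p) - \<pi> (uq_class q p')"
  using uq_representation_hom(1)[of "p - p'" p'] by (simp add: algebra_simps)

lemma uq_representation_scalar: "\<pi> (uq_class q (scalar c)) = mat c"
proof -
  have "\<pi> (uq_class q (scalar c * 1)) = mat c ** \<pi> (uq_class q 1)"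
    using \<pi> by (simp only: uq_representation_def)
  then show ?thesis
    by (simp add: uq_representation_hom(3))
qed

lemmas uq_representation_simps =
  uq_representation_hom uq_representation_diff uq_representation_scalar

lemma uq_representation_relator:
  assumes "p - 1 \<in> uq_relators q"
  shows "\<pi> (uq_class q p) = mat 1"
proof -
  have "\<pi> (uq_class q (p - 1)) = \<pi> (uq_class q (0 - 0))"
    using uq_class_relator[OF assms] by simp
  then show ?thesis
    unfolding uq_representation_simps by simp
qed

lemma uq_representation_z_invertible: "invertible (\<pi> (uq_z q))"
  and uq_representation_z_inv: "\<pi> (uq_class q (gen GZinv)) = matrix_inv (\<pi> (uq_z q))"
proof -
  have "\<pi> (uq_z q) ** \<pi> (uq_class q (gen GZinv)) = mat 1"
    using uq_representation_relator[of "gen GZ * gen GZinv"]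
    by (simp add: uq_representation_simps uq_relators_def uq_z_def)
  then show "invertible (\<pi> (uq_z q))" "\<pi> (uq_class q (gen GZinv)) = matrix_inv (\<pi> (uq_z q))"
    using invertible_right_inverse matrix_inv_unique by metis+
qed

lemma uq_representation_q_comm:
  assumes "q_comm q u v - 1 \<in> uq_relators q" "q \<noteq> 0" "q\<^sup>2 \<noteq> 1"
  shows "\<pi> (uq_class q u) ** \<pi> (uq_class q v) - mat 1 =
    mat (inverse (q\<^sup>2)) ** (\<pi> (uq_class q v) ** \<pi> (uq_class q u) - mat 1)"
proof -
  define UV VU where "UV = \<pi> (uq_class q u) ** \<pi> (uq_class q v)"
    and "VU = \<pi> (uq_class q v) ** \<pi> (uq_class q u)"
  have "\<pi> (uq_class q (q_comm q u v)) = mat 1"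
    by (rule uq_representation_relator[OF assms(1)])
  then have relation:
    "mat (inverse (q - inverse q)) ** (mat q ** UV - mat (inverse q) ** VU) = mat 1"
    by (simp add: q_comm_def uq_representation_simps UV_def VU_def mult.assoc)
  have "q - inverse q \<noteq> 0"
    using assms(2,3) by (auto simp: field_simps power2_eq_square)
  have "(UV - mat 1) $ i $ j = inverse (q\<^sup>2) * (VU - mat 1) $ i $ j" for i j
  proof -
    let ?\<delta> = "(mat 1 :: complex^'x^'x) $ i $ j"
    have "inverse (q - inverse q) * (q * UV $ i $ j - inverse q * VU $ i $ j) = ?\<delta>"
      using arg_cong[OF relation, of "\<lambda>M. M $ i $ j"] by simp
    then have "q * UV $ i $ j - inverse q * VU $ i $ j = (q - inverse q) * ?\<delta>"
      using \<open>q - inverse q \<noteq> 0\<close> by (simp add: divide_simps mult.commute)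
    then show ?thesis
      using assms(2) by (simp add: field_simps power2_eq_square)
  qed
  then show ?thesis
    by (simp add: vec_eq_iff UV_def VU_def)
qed

lemma uq_representation_x_weight:
  assumes "q \<noteq> 0" "q\<^sup>2 \<noteq> 1"
  shows "\<pi> (uq_x q) - matrix_inv (\<pi> (uq_z q)) \<in> weight_space (\<pi> (uq_z q)) (inverse (q\<^sup>2))"
proof -
  have "\<pi> (uq_z q) ** \<pi> (uq_x q) - mat 1 = mat (inverse (q\<^sup>2)) ** (\<pi> (uq_x q) ** \<pi> (uq_z q) - mat 1)"
    unfolding uq_x_def uq_z_def
    by (rule uq_representation_q_comm) (simp_all add: assms uq_relators_def)
  then show ?thesis
    by (simp add: weight_space_def matrix_diff_ldistrib matrix_diff_rdistrib
        matrix_inv_left matrix_inv_right uq_representation_z_invertible)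
qed

lemma uq_representation_y_weight:
  assumes "q \<noteq> 0" "q\<^sup>2 \<noteq> 1"
  shows "\<pi> (uq_y q) - matrix_inv (\<pi> (uq_z q)) \<in> weight_space (\<pi> (uq_z q)) (q\<^sup>2)"
proof -
  have "\<pi> (uq_y q) ** \<pi> (uq_z q) - mat 1 = mat (inverse (q\<^sup>2)) ** (\<pi> (uq_z q) ** \<pi> (uq_y q) - mat 1)"
    unfolding uq_y_def uq_z_def
    by (rule uq_representation_q_comm) (simp_all add: assms uq_relators_def)
  then have "mat (q\<^sup>2) ** (\<pi> (uq_y q) ** \<pi> (uq_z q) - mat 1) = \<pi> (uq_z q) ** \<pi> (uq_y q) - mat 1"
    using assms(1) by (simp add: matrix_mul_assoc mat_mult_mat)
  then show ?thesis
    by (simp add: weight_space_def matrix_diff_ldistrib matrix_diff_rdistrib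
        matrix_inv_left matrix_inv_right uq_representation_z_invertible)
qed

lemma uq_representation_f:
  "\<pi> (uq_f q) = mat (inverse (q - inverse q)) ** (\<pi> (uq_x q) - matrix_inv (\<pi> (uq_z q)))"
  by (simp add: uq_f_def uq_x_def uq_representation_simps uq_representation_z_inv)

lemma uq_representation_e:
  "\<pi> (uq_e q) = mat (- (inverse q * inverse (q - inverse q))) **
     (\<pi> (uq_z q) ** (\<pi> (uq_y q) - matrix_inv (\<pi> (uq_z q))))"
proof -
  have "\<pi> (uq_e q) =
      mat (inverse q * inverse (q - inverse q)) ** (mat 1 - \<pi> (uq_z q) ** \<pi> (uq_y q))"
    by (simp add: uq_e_def uq_y_def uq_z_def uq_representation_simps)
  then show ?thesis
    by (simp add: matrix_diff_ldistrib matrix_inv_right uq_representation_z_invertible)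
      (simp add: vec_eq_iff mat_nth algebra_simps)
qed

end

lemma uq_representation_exchange_x_y:
  fixes P P' :: "complex^'x::finite^'x"
  assumes rep: "uq_representation q \<pi>\<^sub>1" "uq_representation q \<pi>\<^sub>2"
    and q: "q \<noteq> 0" "q ^ 4 \<noteq> 1"
    and z: "\<pi>\<^sub>2 (uq_z q) = \<pi>\<^sub>1 (uq_z q)"
    and P: "\<pi>\<^sub>1 (uq_z q) ** P = P ** \<pi>\<^sub>1 (uq_z q)" "P ** P' = mat 1"
    and nz: "\<kappa> \<noteq> 0" "\<upsilon> \<noteq> 0"
    and sum: "mat \<kappa> ** P' ** \<pi>\<^sub>1 (uq_x q) + mat \<upsilon> ** P ** \<pi>\<^sub>1 (uq_y q) =
      mat \<kappa> ** P' ** \<pi>\<^sub>2 (uq_y q) + mat \<upsilon> ** P ** \<pi>\<^sub>2 (uq_x q)"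
  shows "\<pi>\<^sub>2 (uq_e q) = mat (\<upsilon> / \<kappa>) ** (P ** P) ** \<pi>\<^sub>1 (uq_e q)"
    and "\<pi>\<^sub>2 (uq_f q) = mat (\<kappa> / \<upsilon>) ** (P' ** P') ** \<pi>\<^sub>1 (uq_f q)"
proof -
  define Z where "Z = \<pi>\<^sub>1 (uq_z q)"
  define F\<^sub>1 F\<^sub>2 G\<^sub>1 G\<^sub>2 where "F\<^sub>1 = \<pi>\<^sub>1 (uq_x q) - matrix_inv Z" and "F\<^sub>2 = \<pi>\<^sub>2 (uq_x q) - matrix_inv Z"
    and "G\<^sub>1 = \<pi>\<^sub>1 (uq_y q) - matrix_inv Z" and "G\<^sub>2 = \<pi>\<^sub>2 (uq_y q) - matrix_inv Z"
  note FG_defs = F\<^sub>1_def F\<^sub>2_def G\<^sub>1_def G\<^sub>2_def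
  have q2: "q\<^sup>2 \<noteq> 1" "inverse (q\<^sup>2) \<noteq> q\<^sup>2"
    using q by (auto simp: field_simps power4_eq_xxxx power2_eq_square)
  have weights: "F\<^sub>1 \<in> weight_space Z (inverse (q\<^sup>2))" "F\<^sub>2 \<in> weight_space Z (inverse (q\<^sup>2))"
    "G\<^sub>1 \<in> weight_space Z (q\<^sup>2)" "G\<^sub>2 \<in> weight_space Z (q\<^sup>2)"
    using rep[THEN uq_representation_x_weight] rep[THEN uq_representation_y_weight] q(1) q2(1)
    by (simp_all add: FG_defs Z_def z)
  have "invertible Z"
    using uq_representation_z_invertible[OF rep(1)] by (simp add: Z_def)
  moreover have "mat \<kappa> ** P' ** F\<^sub>1 + mat \<upsilon> ** P ** G\<^sub>1 = mat \<kappa> ** P' ** G\<^sub>2 + mat \<upsilon> ** P ** F\<^sub>2"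
    using sum by (simp add: FG_defs matrix_diff_ldistrib algebra_simps)
  ultimately have F: "F\<^sub>2 = mat (\<kappa> / \<upsilon>) ** (P' ** P') ** F\<^sub>1"
    and G: "G\<^sub>2 = mat (\<upsilon> / \<kappa>) ** (P ** P) ** G\<^sub>1"
    by (rule weight_components_exchange[OF _ q2(2) weights P[folded Z_def] nz])+
  show "\<pi>\<^sub>2 (uq_f q) = mat (\<kappa> / \<upsilon>) ** (P' ** P') ** \<pi>\<^sub>1 (uq_f q)"
    using rep[THEN uq_representation_f] F
    by (simp add: FG_defs Z_def z mult_mat_mult[of "mat (\<kappa> / \<upsilon>) ** (P' ** P')"])
  have "Z ** G\<^sub>2 = mat (\<upsilon> / \<kappa>) ** (P ** P) ** (Z ** G\<^sub>1)"
  proof -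
    have "Z ** G\<^sub>2 = mat (\<upsilon> / \<kappa>) ** (Z ** (P ** P) ** G\<^sub>1)"
      by (simp add: G mult_mat_mult[of Z] flip: matrix_mul_assoc)
    also have "Z ** (P ** P) = P ** P ** Z"
      using P(1) by (metis Z_def matrix_mul_assoc)
    finally show ?thesis
      by (simp add: matrix_mul_assoc)
  qed
  then show "\<pi>\<^sub>2 (uq_e q) = mat (\<upsilon> / \<kappa>) ** (P ** P) ** \<pi>\<^sub>1 (uq_e q)"
    using rep[THEN uq_representation_e]
    by (simp add: FG_defs Z_def z mult_mat_mult[of "mat (\<upsilon> / \<kappa>) ** (P ** P)"])
qed

section \<open>The two module structures\<close>

lemma param_upsilon_nonzero: "q > 1 \<Longrightarrow> param_upsilon q D \<noteq> 0"
  by (simp add: param_upsilon_def power2_eq_1_iff)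

lemma param_kappa_eq_param_upsilon:
  "q > 0 \<Longrightarrow> param_kappa q D e = - (q powr (2 * e)) * param_upsilon q D"
  by (simp add: param_kappa_def param_upsilon_def powr_add powr_realpow)

lemma param_kappa_star_nonzero:
  assumes "b > 1" "q > 0"
  shows "param_kappa_star b q D e \<noteq> 0"
proof -
  have "b powr r + 1 > 0" "b powr r + b > 0" for r
    using assms(1) powr_ge_zero[of b r] by linarith+
  then show ?thesis
    using assms unfolding param_kappa_star_def param_xi_def by (simp add: less_imp_neq[symmetric])
qed

lemma dual_adjacency_equation_z:
  assumes "dual_adjacency_equation b q D e As \<Upsilon> \<Psi> \<pi>"
    and "invertible \<Upsilon>" "invertible \<Psi>" "param_kappa_star b q D e \<noteq> 0"
  shows "\<pi> (uq_z (of_real q)) = cmat (inverse (param_kappa_star b q D e)) **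
    (\<Psi> ** (\<Upsilon> ** (As - cmat (param_h_star b D e))))"
proof -
  define \<kappa>s where "\<kappa>s = param_kappa_star b q D e"
  have "As - cmat (param_h_star b D e) =
      cmat \<kappa>s ** (matrix_inv \<Upsilon> ** (matrix_inv \<Psi> ** \<pi> (uq_z (of_real q))))"
    using assms(1) by (simp add: dual_adjacency_equation_def \<kappa>s_def matrix_mul_assoc)
  then have "\<Psi> ** (\<Upsilon> ** (As - cmat (param_h_star b D e))) =
      cmat \<kappa>s ** (\<Psi> ** (\<Upsilon> ** matrix_inv \<Upsilon>) ** matrix_inv \<Psi> ** \<pi> (uq_z (of_real q)))"
    by (simp add: cmat_def mult_mat_mult flip: matrix_mul_assoc)
  also have "\<dots> = cmat \<kappa>s ** \<pi> (uq_z (of_real q))"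
    by (simp add: matrix_inv_right assms(2,3))
  finally show ?thesis
    using assms(4) by (simp add: vec_eq_iff cmat_def flip: \<kappa>s_def)
qed

lemma dual_adjacency_equation_z_mem:
  assumes "dual_adjacency_equation b q D e As \<Upsilon> \<Psi> \<pi>"
    and "invertible \<Upsilon>" "invertible \<Psi>" "param_kappa_star b q D e \<noteq> 0"
    and "\<Upsilon> \<in> generated_algebra G" "\<Psi> \<in> generated_algebra G" "As \<in> generated_algebra G"
  shows "\<pi> (uq_z (of_real q)) \<in> generated_algebra G"
  unfolding dual_adjacency_equation_z[OF assms(1-4)] cmat_def
  by (intro generated_algebra.intros(2,4) generated_algebra_diff assms(5-7))

context
  fixes b q e :: real and D :: nat and A As \<Upsilon> \<Psi> :: "complex^'x::finite^'x"
    and G :: "(complex^'x^'x) set" and \<pi>\<^sub>1 \<pi>\<^sub>2 :: "free_uq set \<Rightarrow> complex^'x^'x"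
  assumes structures: "first_module_structure b q D e A As \<Upsilon> \<Psi> \<pi>\<^sub>1"
      "second_module_structure b q D e A As \<Upsilon> \<Psi> \<pi>\<^sub>2"
    and b: "b > 1" and q: "q > 1"
    and central: "\<Upsilon> \<in> center_of (generated_algebra G)" "\<Psi> \<in> center_of (generated_algebra G)"
    and inv: "invertible \<Upsilon>" "invertible \<Psi>"
    and As: "As \<in> generated_algebra G"
begin

lemma module_structures_dual_adjacency_equation:
  "dual_adjacency_equation b q D e As \<Upsilon> \<Psi> \<pi>\<^sub>1" "dual_adjacency_equation b q D e As \<Upsilon> \<Psi> \<pi>\<^sub>2"
  using structures by (simp_all add: first_module_structure_def second_module_structure_def)

lemma second_module_structure_z: "\<pi>\<^sub>2 (uq_z (of_real q)) = \<pi>\<^sub>1 (uq_z (of_real q))"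
  using module_structures_dual_adjacency_equation b q
  by (simp add: dual_adjacency_equation_z inv param_kappa_star_nonzero)

lemma first_module_structure_z_commute_quotient:
  "\<pi>\<^sub>1 (uq_z (of_real q)) ** (\<Upsilon> ** matrix_inv \<Psi>) = \<Upsilon> ** matrix_inv \<Psi> ** \<pi>\<^sub>1 (uq_z (of_real q))"
proof -
  let ?Z = "\<pi>\<^sub>1 (uq_z (of_real q))"
  have "\<Upsilon> \<in> generated_algebra G" "\<Psi> \<in> generated_algebra G"
    using central unfolding center_of_def by blast+
  moreover have "param_kappa_star b q D e \<noteq> 0"
    using b q by (simp add: param_kappa_star_nonzero)
  ultimately have "?Z \<in> generated_algebra G"
    by (intro dual_adjacency_equation_z_mem[OF module_structures_dual_adjacency_equation(1) inv] As)
  then have "\<Upsilon> ** ?Z = ?Z ** \<Upsilon>" "\<Psi> ** ?Z = ?Z ** \<Psi>"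
    using central unfolding center_of_def by blast+
  then show ?thesis
    using matrix_inv_commute[OF inv(2)] by (metis matrix_mul_assoc)
qed

lemma
  shows second_module_structure_e: "\<pi>\<^sub>2 (uq_e (of_real q)) =
      cmat (- (q powr (- 2 * e))) ** (\<Upsilon> ** \<Upsilon>) ** (matrix_inv \<Psi> ** matrix_inv \<Psi>) ** \<pi>\<^sub>1 (uq_e (of_real q))"
    and second_module_structure_f: "\<pi>\<^sub>2 (uq_f (of_real q)) =
      cmat (- (q powr (2 * e))) ** (matrix_inv \<Upsilon> ** matrix_inv \<Upsilon>) ** (\<Psi> ** \<Psi>) ** \<pi>\<^sub>1 (uq_f (of_real q))"
proof -
  let ?q = "complex_of_real q"
  define \<kappa> \<upsilon> where "\<kappa> = param_kappa q D e" and "\<upsilon> = param_upsilon q D"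
  define P P' where "P = \<Upsilon> ** matrix_inv \<Psi>" and "P' = matrix_inv \<Upsilon> ** \<Psi>"
  have "\<upsilon> \<noteq> 0" "\<kappa> \<noteq> 0" and ratio: "\<upsilon> / \<kappa> = - (q powr (- 2 * e))" "\<kappa> / \<upsilon> = - (q powr (2 * e))"
    using q param_kappa_eq_param_upsilon[of q D e] param_upsilon_nonzero[of q D]
    by (simp_all add: \<kappa>_def \<upsilon>_def powr_minus field_simps)
  have "\<Upsilon> ** \<Psi> = \<Psi> ** \<Upsilon>"
    using central unfolding center_of_def by blast
  note P_mult_P' = commuting_quotient_mult_inverse[OF inv this]
    and P_square = commuting_quotient_square[OF inv this]
    and P'_square = commuting_quotient_inverse_square[OF inv this]
  have rep: "uq_representation ?q \<pi>\<^sub>1" "uq_representation ?q \<pi>\<^sub>2"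
    using structures by (simp_all add: first_module_structure_def second_module_structure_def)
  have "?q \<noteq> 0" "?q ^ 4 \<noteq> 1"
    using q power_eq_1_iff[of ?q 4] by auto
  moreover have "mat \<kappa> ** P' ** \<pi>\<^sub>1 (uq_x ?q) + mat \<upsilon> ** P ** \<pi>\<^sub>1 (uq_y ?q) =
      mat \<kappa> ** P' ** \<pi>\<^sub>2 (uq_y ?q) + mat \<upsilon> ** P ** \<pi>\<^sub>2 (uq_x ?q)"
    using structures
    by (simp add: first_module_structure_def second_module_structure_def P_def P'_def
        \<kappa>_def \<upsilon>_def cmat_def matrix_mul_assoc add.assoc)
  ultimately have "\<pi>\<^sub>2 (uq_e ?q) = mat (of_real \<upsilon> / of_real \<kappa>) ** (P ** P) ** \<pi>\<^sub>1 (uq_e ?q)"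
    "\<pi>\<^sub>2 (uq_f ?q) = mat (of_real \<kappa> / of_real \<upsilon>) ** (P' ** P') ** \<pi>\<^sub>1 (uq_f ?q)"
    using uq_representation_exchange_x_y[OF rep _ _ second_module_structure_z
        first_module_structure_z_commute_quotient[folded P_def] P_mult_P'[folded P_def P'_def]]
      \<open>\<upsilon> \<noteq> 0\<close> \<open>\<kappa> \<noteq> 0\<close> by simp_all
  then show "\<pi>\<^sub>2 (uq_e ?q) =
      cmat (- (q powr (- 2 * e))) ** (\<Upsilon> ** \<Upsilon>) ** (matrix_inv \<Psi> ** matrix_inv \<Psi>) ** \<pi>\<^sub>1 (uq_e ?q)"
    and "\<pi>\<^sub>2 (uq_f ?q) =
      cmat (- (q powr (2 * e))) ** (matrix_inv \<Upsilon> ** matrix_inv \<Upsilon>) ** (\<Psi> ** \<Psi>) ** \<pi>\<^sub>1 (uq_f ?q)"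
    unfolding P_def P'_def P_square P'_square
    by (simp_all only: ratio cmat_def matrix_mul_assoc flip: of_real_divide)
qed

end

theorem theorem30p5:
  fixes smul :: "'k::{field,finite} \<Rightarrow> 'u::ab_group_add \<Rightarrow> 'u"
    and F :: "('k, 'u) polar_form"
    and D :: nat
    and e b q :: real
    and vert :: "'x::finite \<Rightarrow> 'u set"
    and x :: 'x
    and A As \<Upsilon> \<Psi> :: "complex^'x^'x"
    and E Es :: "nat \<Rightarrow> complex^'x^'x"
    and T :: "(complex^'x^'x) set"
    and \<pi>\<^sub>1 \<pi>\<^sub>2 :: "free_uq set \<Rightarrow> complex^'x^'x"
  assumes "vector_space smul"
    and "D \<ge> 3"
    and "dual_polar_type smul F D e"
    and "bij_betw vert UNIV (maximal_isotropic_subspaces smul F)"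
    and "b = real CARD('k)"
    and "q = sqrt b"
    and "A = adjacency_matrix smul D vert"
    and "E = eigenprojection A"
    and "Es = dual_idempotent smul D vert x"
    and "As = dual_adjacency_matrix A x"
    and "T = generated_algebra {A, As}"
    and "is_Upsilon T q D E Es \<Upsilon>"
    and "is_Psi T q D E Es \<Psi>"
    and "first_module_structure b q D e A As \<Upsilon> \<Psi> \<pi>\<^sub>1"
    and "second_module_structure b q D e A As \<Upsilon> \<Psi> \<pi>\<^sub>2"
  shows "\<pi>\<^sub>2 (uq_k (of_real q)) = \<pi>\<^sub>1 (uq_k (of_real q))
    \<and> \<pi>\<^sub>2 (uq_e (of_real q)) =
        cmat (- (q powr (- 2 * e))) ** (\<Upsilon> ** \<Upsilon>) ** (matrix_inv \<Psi> ** matrix_inv \<Psi>) ** \<pi>\<^sub>1 (uq_e (of_real q))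
    \<and> \<pi>\<^sub>2 (uq_f (of_real q)) =
        cmat (- (q powr (2 * e))) ** (matrix_inv \<Upsilon> ** matrix_inv \<Upsilon>) ** (\<Psi> ** \<Psi>) ** \<pi>\<^sub>1 (uq_f (of_real q))"
proof -
  have "card {0, 1 :: 'k} \<le> CARD('k)"
    by (rule card_mono) simp_all
  then have "b > 1" "q > 1"
    using \<open>b = real CARD('k)\<close> \<open>q = sqrt b\<close> by simp_all
  have acts: "\<exists>\<phi>. acts_by_power T q \<phi> \<Upsilon>" "\<exists>\<phi>. acts_by_power T q \<phi> \<Psi>"
    using \<open>is_Upsilon T q D E Es \<Upsilon>\<close> \<open>is_Psi T q D E Es \<Psi>\<close>
    unfolding is_Upsilon_def is_Psi_def by blast+
  then have central: "\<Upsilon> \<in> center_of (generated_algebra {A, As})"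
    "\<Psi> \<in> center_of (generated_algebra {A, As})"
    by (auto simp: acts_by_power_def \<open>T = generated_algebra {A, As}\<close>)
  have inv: "invertible \<Upsilon>" "invertible \<Psi>"
    using acts acts_by_power_invertible \<open>q > 1\<close> by fastforce+
  have As: "As \<in> generated_algebra {A, As}"
    by (simp add: generated_algebra.intros)
  note structure_facts = \<open>first_module_structure b q D e A As \<Upsilon> \<Psi> \<pi>\<^sub>1\<close>
    \<open>second_module_structure b q D e A As \<Upsilon> \<Psi> \<pi>\<^sub>2\<close> \<open>b > 1\<close> \<open>q > 1\<close> central inv As
  show ?thesis
    unfolding uq_k_def
    by (intro conjI second_module_structure_z[OF structure_facts]
        second_module_structure_e[OF structure_facts] second_module_structure_f[OF structure_facts])
qed

end
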